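(* Let $a<b$ be real numbers, let $f:[a,b]\to\mathbb{R}$ be continuously differentiable, and let $\Phi:[0,b-a]\to[0,\infty)$ be continuously differentiable with $\Phi'\ge 0$ and $\Phi(0)=0$. Assume that $f'$ is $\Phi'$-superadditive, i.e. $f'(y)-f'(x)\ge \Phi'(y-x)$ for all $x,y\in[a,b]$ with $x\le y$. Let $(a_1,\dots,a_n)$ be a real $n$-tuple, put $A_j=\sum_{i=1}^{j}a_i$, and assume $0\le A_j\le A_n$ for $j=1,\dots,n$ and $A_n>0$. Let $x_1\le x_2\le\dots\le x_n$ be points of $[a,b]$ and let $\overline{x}=\frac{1}{A_n}\sum_{i=1}^n a_ix_i$. Then for all $c\in[a,b]$ $$f(c)+f'(c)(\overline{x}-c)+\frac{1}{A_n}\sum_{i=1}^n a_i\,\Phi(|x_i-c|)\le \frac{1}{A_n}\sum_{i=1}^n a_i f(x_i).$$ In particular, taking $c=\overline{x}$, $$\frac{1}{A_n}\sum_{i=1}^n a_i f(x_i)\ge f(\overline{x})+\frac{1}{A_n}\sum_{i=1}^n a_i\,\Phi(|x_i-\overline{x}|).$$ If in addition $\Phi$ is convex, then for all $c\in[a,b]$ $$\frac{1}{A_n}\sum_{i=1}^n a_i f(x_i)-f(c)-f'(c)(\overline{x}-c)\ge \frac{1}{A_n}\sum_{i=1}^n a_i\,\Phi(|x_i-c|)\ge 0.$$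
   Context: The coefficients $a_i$ are allowed to be negative. Derivatives at endpoints of closed intervals are one-sided. *)

theory Defs
  imports "HOL-Analysis.Analysis"
begin

(* f' is the derivative of f relative to {a..b}; hence it is one-sided at the endpoints. *)
definition C1_on_interval :: "real \<Rightarrow> real \<Rightarrow> (real \<Rightarrow> real) \<Rightarrow> (real \<Rightarrow> real) \<Rightarrow> bool" where
  "C1_on_interval a b f f' \<longleftrightarrow>
     (\<forall>x\<in>{a..b}. (f has_real_derivative f' x) (at x within {a..b})) \<and> continuous_on {a..b} f'"

definition superadditive_wrt_on ::
    "(real \<Rightarrow> real) \<Rightarrow> real set \<Rightarrow> (real \<Rightarrow> real) \<Rightarrow> bool" where
  "superadditive_wrt_on \<psi> S g \<longleftrightarrow>
     (\<forall>x\<in>S. \<forall>y\<in>S. x \<le> y \<longrightarrow> g y - g x \<ge> \<psi> (y - x))"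

end

theory Submission
  imports Defs
begin

text \<open>For fixed \<open>c\<close>, the function \<open>g x = f x - f c - f' c * (x - c) - \<Phi> \<bar>x - c\<bar>\<close> vanishes at \<open>c\<close>,
  and superadditivity says that it is decreasing to the left of \<open>c\<close> and increasing to the right.
  Such a \<open>g\<close> is the sum of the monotone nonnegative functions \<open>g (min x c)\<close> and \<open>g (max x c)\<close>,
  and summation by parts with Steffensen's condition on the weights shows that each has
  a nonnegative weighted sum. The same applies to \<open>\<Phi> \<bar>x - c\<bar>\<close> itself, for which the sign of \<open>\<Phi>'\<close>
  suffices, and to \<open>x - a\<close> and \<open>b - x\<close>, which places the barycentre in \<open>[a, b]\<close>.\<close>

text \<open>Abel summation: with \<open>W j\<close> the sum of the first \<open>j\<close> weights,
  the weighted sum is \<open>W n * h n\<close> plus the sum of \<open>W j * (h j - h (j+1))\<close>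
  over \<open>j < n\<close>, and every term is nonnegative.\<close>

lemma weighted_sum_nonneg_antimono:
  fixes w h :: "nat \<Rightarrow> real"
  assumes part: "\<And>j. j \<in> {1..n} \<Longrightarrow> 0 \<le> (\<Sum>i=1..j. w i)"
    and anti: "antimono_on {1..n} h"
    and nonneg: "\<And>i. i \<in> {1..n} \<Longrightarrow> 0 \<le> h i"
  shows "0 \<le> (\<Sum>i=1..n. w i * h i)"
proof (cases "n = 0")
  case False
  \<comment> \<open>In the induction step, lowering \<open>h m\<close> to \<open>h (Suc m)\<close>
    shrinks the left side because the partial sum is nonnegative; then both sides gain
    \<open>w (Suc m) * h (Suc m)\<close>.\<close>
  have "(\<Sum>i=1..m. w i) * h m \<le> (\<Sum>i=1..m. w i * h i)" if "1 \<le> m" "m \<le> n" for m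
    using that
  proof (induction m rule: dec_induct)
    case base
    show ?case by simp
  next
    case (step m)
    have "h (Suc m) \<le> h m"
      using step by (intro monotone_onD[OF anti]) auto
    then have "(\<Sum>i=1..m. w i) * h (Suc m) \<le> (\<Sum>i=1..m. w i) * h m"
      using step by (intro mult_left_mono part) auto
    also have "\<dots> \<le> (\<Sum>i=1..m. w i * h i)"
      using step by auto
    finally show ?case
      by (simp add: algebra_simps)
  qed
  from this[of n] False have "(\<Sum>i=1..n. w i) * h n \<le> (\<Sum>i=1..n. w i * h i)"
    by auto
  moreover have "0 \<le> (\<Sum>i=1..n. w i) * h n"
    using False by (intro mult_nonneg_nonneg part nonneg) auto
  ultimately show ?thesis by linarith
qed simp

text \<open>The mirror image: summation by parts now puts the tails of the weights, nonnegative by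
  \<open>part\<close>, in front of the increments of \<open>h\<close>.\<close>

lemma weighted_sum_nonneg_mono:
  fixes w h :: "nat \<Rightarrow> real"
  assumes part: "\<And>j. j \<in> {1..n} \<Longrightarrow> (\<Sum>i=1..j. w i) \<le> (\<Sum>i=1..n. w i)"
    and total: "0 \<le> (\<Sum>i=1..n. w i)"
    and mono: "mono_on {1..n} h"
    and nonneg: "\<And>i. i \<in> {1..n} \<Longrightarrow> 0 \<le> h i"
  shows "0 \<le> (\<Sum>i=1..n. w i * h i)"
proof (cases "n = 0")
  case False
  define T where "T = (\<Sum>i=1..n. w i)"
  \<comment> \<open>The right side is the weighted sum with all weight beyond \<open>m\<close> moved
    to the value \<open>h m\<close>. It equals \<open>T * h 1\<close> at \<open>m = 1\<close>, grows
    with \<open>m\<close>, and is the full sum at \<open>m = n\<close>.\<close>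
  have "T * h 1 \<le> (\<Sum>i=1..m. w i * h i) + (T - (\<Sum>i=1..m. w i)) * h m"
    if "1 \<le> m" "m \<le> n" for m
    using that
  proof (induction m rule: dec_induct)
    case base
    show ?case by (simp add: algebra_simps)
  next
    case (step m)
    have "h m \<le> h (Suc m)"
      using step by (intro monotone_onD[OF mono]) auto
    then have "(T - (\<Sum>i=1..m. w i)) * h m \<le> (T - (\<Sum>i=1..m. w i)) * h (Suc m)"
      using step part[of m] by (intro mult_left_mono) (auto simp: T_def)
    moreover have "T * h 1 \<le> (\<Sum>i=1..m. w i * h i) + (T - (\<Sum>i=1..m. w i)) * h m"
      using step by auto
    ultimately show ?case
      by (simp add: algebra_simps)
  qed
  from this[of n] False have "T * h 1 \<le> (\<Sum>i=1..n. w i * h i)"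
    by (auto simp: T_def)
  moreover have "0 \<le> T * h 1"
    using False total by (intro mult_nonneg_nonneg nonneg) (auto simp: T_def)
  ultimately show ?thesis by linarith
qed simp

lemma weighted_sum_nonneg_valley:
  fixes w x :: "nat \<Rightarrow> real" and g :: "real \<Rightarrow> real"
  assumes part: "\<And>j. j \<in> {1..n} \<Longrightarrow> 0 \<le> (\<Sum>i=1..j. w i) \<and> (\<Sum>i=1..j. w i) \<le> (\<Sum>i=1..n. w i)"
    and total: "0 \<le> (\<Sum>i=1..n. w i)"
    and x: "\<And>i. i \<in> {1..n} \<Longrightarrow> x i \<in> {a..b}" "mono_on {1..n} x"
    and c: "c \<in> {a..b}"
    and anti: "antimono_on {a..c} g" and mono: "mono_on {c..b} g" and "g c = 0"
  shows "0 \<le> (\<Sum>i=1..n. w i * g (x i))"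
proof -
  have "0 \<le> (\<Sum>i=1..n. w i * g (min (x i) c))"
  proof (rule weighted_sum_nonneg_antimono)
    show "antimono_on {1..n} (\<lambda>i. g (min (x i) c))"
    proof (rule monotone_onI)
      fix i j assume ij: "i \<in> {1..n}" "j \<in> {1..n}" "i \<le> j"
      then show "g (min (x j) c) \<le> g (min (x i) c)"
        using c x(1)[of i] x(1)[of j] monotone_onD[OF x(2) ij]
        by (intro monotone_onD[OF anti]) auto
    qed
    show "0 \<le> g (min (x i) c)" if "i \<in> {1..n}" for i
      using monotone_onD[OF anti, of "min (x i) c" c] c x(1)[OF that] \<open>g c = 0\<close> by auto
  qed (use part in auto)
  moreover have "0 \<le> (\<Sum>i=1..n. w i * g (max (x i) c))"
  proof (rule weighted_sum_nonneg_mono)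
    show "mono_on {1..n} (\<lambda>i. g (max (x i) c))"
    proof (rule monotone_onI)
      fix i j assume ij: "i \<in> {1..n}" "j \<in> {1..n}" "i \<le> j"
      then show "g (max (x i) c) \<le> g (max (x j) c)"
        using c x(1)[of i] x(1)[of j] monotone_onD[OF x(2) ij]
        by (intro monotone_onD[OF mono]) auto
    qed
    show "0 \<le> g (max (x i) c)" if "i \<in> {1..n}" for i
      using monotone_onD[OF mono, of c "max (x i) c"] c x(1)[OF that] \<open>g c = 0\<close> by auto
  qed (use part total in auto)
  \<comment> \<open>One of \<open>min (x i) c\<close> and \<open>max (x i) c\<close> is
    \<open>x i\<close>; the other is \<open>c\<close>, where \<open>g\<close> vanishes.\<close>
  moreover have "g (x i) = g (min (x i) c) + g (max (x i) c)" for i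
    using \<open>g c = 0\<close> by (auto simp: min_def max_def)
  then have "(\<Sum>i=1..n. w i * g (x i))
      = (\<Sum>i=1..n. w i * g (min (x i) c)) + (\<Sum>i=1..n. w i * g (max (x i) c))"
    by (simp only: distrib_left sum.distrib)
  ultimately show ?thesis by linarith
qed

lemma mono_on_if_deriv_within_nonneg:
  fixes g g' :: "real \<Rightarrow> real"
  assumes deriv: "\<And>x. x \<in> {u..v} \<Longrightarrow> (g has_real_derivative g' x) (at x within {u..v})"
    and nonneg: "\<And>x. x \<in> {u..v} \<Longrightarrow> 0 \<le> g' x"
  shows "mono_on {u..v} g"
proof (rule monotone_onI)
  fix s t assume st: "s \<in> {u..v}" "t \<in> {u..v}" "s \<le> t"
  show "g s \<le> g t"
  proof (rule DERIV_nonneg_imp_increasing_open[OF \<open>s \<le> t\<close>])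
    \<comment> \<open>Strictly between \<open>s\<close> and \<open>t\<close> the derivative is
      two-sided; continuity takes care of the endpoints.\<close>
    fix x assume "s < x" "x < t"
    then have "(g has_real_derivative g' x) (at x)"
      using deriv[of x] st by (simp add: at_within_Icc_at)
    then show "\<exists>y. (g has_real_derivative y) (at x) \<and> 0 \<le> y"
      using nonneg[of x] st \<open>s < x\<close> \<open>x < t\<close> by auto
  next
    have "continuous_on {u..v} g"
      using deriv by (rule DERIV_continuous_on)
    then show "continuous_on {s..t} g"
      by (rule continuous_on_subset) (use st in auto)
  qed
qed

lemma antimono_on_if_deriv_within_nonpos:
  fixes g g' :: "real \<Rightarrow> real"
  assumes "\<And>x. x \<in> {u..v} \<Longrightarrow> (g has_real_derivative g' x) (at x within {u..v})"
    and "\<And>x. x \<in> {u..v} \<Longrightarrow> g' x \<le> 0"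
  shows "antimono_on {u..v} g"
proof -
  have "mono_on {u..v} (\<lambda>x. - g x)"
    by (rule mono_on_if_deriv_within_nonneg[where g' = "\<lambda>x. - g' x"])
      (use assms in \<open>auto intro: DERIV_minus\<close>)
  then show ?thesis
    by (auto simp: monotone_on_def)
qed

text \<open>Off \<open>c\<close>, the derivative of \<open>g\<close> is \<open>f' x - f' c\<close>
  plus or minus \<Phi>' at the distance to \<open>c\<close>; superadditivity for the ordered pair of
  \<open>x\<close> and \<open>c\<close> fixes its sign.\<close>

lemma tangent_gap_valley:
  assumes f: "C1_on_interval a b f f'" and \<Phi>: "C1_on_interval 0 (b - a) \<Phi> \<Phi>'"
    and super: "superadditive_wrt_on \<Phi>' {a..b} f'"
    and c: "c \<in> {a..b}"
  defines "g \<equiv> \<lambda>x. f x - f c - f' c * (x - c) - \<Phi> \<bar>x - c\<bar>"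
  shows "antimono_on {a..c} g" and "mono_on {c..b} g"
proof -
  have df: "(f has_real_derivative f' x) (at x within S)"
    if "S \<subseteq> {a..b}" "x \<in> S" for S x
    using f that by (auto simp: C1_on_interval_def intro: DERIV_subset)
  \<comment> \<open>A general \<open>S\<close> is needed because the chain rule below differentiates
    \<Phi> within the image of \<open>{a..c}\<close> or \<open>{c..b}\<close> under the inner
    map.\<close>
  have d\<Phi>: "(\<Phi> has_real_derivative \<Phi>' t) (at t within S)"
    if "S \<subseteq> {0..b - a}" "t \<in> S" for S t
    using \<Phi> that by (auto simp: C1_on_interval_def intro: DERIV_subset)
  \<comment> \<open>On each side of \<open>c\<close> the absolute value is replaced by its linear
    branch, so it is never differentiated at its kink.\<close>
  have "antimono_on {a..c} (\<lambda>x. f x - f c - f' c * (x - c) - \<Phi> (c - x))"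
  proof (rule antimono_on_if_deriv_within_nonpos)
    fix x assume x: "x \<in> {a..c}"
    have "((\<lambda>x. \<Phi> (c - x)) has_real_derivative \<Phi>' (c - x) * (- 1)) (at x within {a..c})"
      by (rule DERIV_image_chain[unfolded o_def, OF d\<Phi>])
        (use x c in \<open>auto intro!: derivative_eq_intros\<close>)
    then show "((\<lambda>x. f x - f c - f' c * (x - c) - \<Phi> (c - x)) has_real_derivative
        f' x - f' c + \<Phi>' (c - x)) (at x within {a..c})"
      using x c by (auto intro!: derivative_eq_intros df)
    show "f' x - f' c + \<Phi>' (c - x) \<le> 0"
      using super[unfolded superadditive_wrt_on_def, rule_format, of x c] x c by auto
  qed
  then show "antimono_on {a..c} g"
    by (auto simp: monotone_on_def g_def)
  have "mono_on {c..b} (\<lambda>x. f x - f c - f' c * (x - c) - \<Phi> (x - c))"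
  proof (rule mono_on_if_deriv_within_nonneg)
    fix x assume x: "x \<in> {c..b}"
    have "((\<lambda>x. \<Phi> (x - c)) has_real_derivative \<Phi>' (x - c) * 1) (at x within {c..b})"
      by (rule DERIV_image_chain[unfolded o_def, OF d\<Phi>])
        (use x c in \<open>auto intro!: derivative_eq_intros\<close>)
    then show "((\<lambda>x. f x - f c - f' c * (x - c) - \<Phi> (x - c)) has_real_derivative
        f' x - f' c - \<Phi>' (x - c)) (at x within {c..b})"
      using x c by (auto intro!: derivative_eq_intros df)
    show "0 \<le> f' x - f' c - \<Phi>' (x - c)"
      using super x c by (auto simp: superadditive_wrt_on_def)
  qed
  then show "mono_on {c..b} g"
    by (auto simp: monotone_on_def g_def)
qed

theorem theorem6:
  fixes a b xbar :: real
    and f f' \<Phi> \<Phi>' :: "real \<Rightarrow> real"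
    and n :: nat
    and w x A :: "nat \<Rightarrow> real"
  assumes "a < b"
    and "C1_on_interval a b f f'"
    and "C1_on_interval 0 (b - a) \<Phi> \<Phi>'"
    and "\<forall>t\<in>{0..b - a}. 0 \<le> \<Phi> t"
    and "\<forall>t\<in>{0..b - a}. 0 \<le> \<Phi>' t"
    and "\<Phi> 0 = 0"
    and "superadditive_wrt_on \<Phi>' {a..b} f'"
    and A_def: "A = (\<lambda>j. \<Sum>i=1..j. w i)"
    and "\<forall>j\<in>{1..n}. 0 \<le> A j \<and> A j \<le> A n"
    and "0 < A n"
    and "\<forall>i\<in>{1..n}. x i \<in> {a..b}"
    and "mono_on {1..n} x"
    and xbar_def: "xbar = 1 / A n * (\<Sum>i=1..n. w i * x i)"
  shows "(\<forall>c\<in>{a..b}.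
            f c + f' c * (xbar - c) + 1 / A n * (\<Sum>i=1..n. w i * \<Phi> \<bar>x i - c\<bar>)
              \<le> 1 / A n * (\<Sum>i=1..n. w i * f (x i)))
       \<and> (xbar \<in> {a..b} \<and>
            1 / A n * (\<Sum>i=1..n. w i * f (x i))
              \<ge> f xbar + 1 / A n * (\<Sum>i=1..n. w i * \<Phi> \<bar>x i - xbar\<bar>))
       \<and> (convex_on {0..b - a} \<Phi> \<longrightarrow>
            (\<forall>c\<in>{a..b}.
               1 / A n * (\<Sum>i=1..n. w i * f (x i)) - f c - f' c * (xbar - c)
                 \<ge> 1 / A n * (\<Sum>i=1..n. w i * \<Phi> \<bar>x i - c\<bar>)
             \<and> 1 / A n * (\<Sum>i=1..n. w i * \<Phi> \<bar>x i - c\<bar>) \<ge> 0))"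
proof -
  have part: "0 \<le> (\<Sum>i=1..j. w i) \<and> (\<Sum>i=1..j. w i) \<le> (\<Sum>i=1..n. w i)"
    if "j \<in> {1..n}" for j
    using assms(9) that by (simp add: A_def)
  have total: "0 \<le> (\<Sum>i=1..n. w i)"
    using \<open>0 < A n\<close> by (simp add: A_def)
  have valley: "0 \<le> (\<Sum>i=1..n. w i * g (x i))"
    if "c \<in> {a..b}" "antimono_on {a..c} g" "mono_on {c..b} g" "g c = 0" for g c
    using weighted_sum_nonneg_valley[of n w x a b c g] part total assms(11,12) that by blast
  have sum_affine: "(\<Sum>i=1..n. w i * (p + q * x i)) = A n * (p + q * xbar)" for p q
  proof -
    have "(\<Sum>i=1..n. w i * (p + q * x i)) = p * A n + q * (\<Sum>i=1..n. w i * x i)"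
      by (simp add: A_def distrib_left sum.distrib sum_distrib_left mult_ac)
    also have "(\<Sum>i=1..n. w i * x i) = A n * xbar"
      using \<open>0 < A n\<close> by (simp add: xbar_def)
    finally show ?thesis by (simp add: algebra_simps)
  qed
  \<comment> \<open>The valley has its bottom at the endpoint \<open>a\<close>, so its left branch
    is a single point. The factor \<open>1\<close> matches the shape of
    \<open>sum_affine\<close>.\<close>
  have "0 \<le> A n * (xbar - a)"
    using valley[of a "\<lambda>x. - a + 1 * x"] sum_affine[of "- a" 1] \<open>a < b\<close>
    by (auto simp: monotone_on_def)
  moreover have "0 \<le> A n * (b - xbar)"
    using valley[of b "\<lambda>x. b + (- 1) * x"] sum_affine[of b "- 1"] \<open>a < b\<close>
    by (auto simp: monotone_on_def)
  ultimately have xbar: "xbar \<in> {a..b}"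
    using \<open>0 < A n\<close> by (simp add: zero_le_mult_iff)
  have main: "f c + f' c * (xbar - c) + 1 / A n * (\<Sum>i=1..n. w i * \<Phi> \<bar>x i - c\<bar>)
      \<le> 1 / A n * (\<Sum>i=1..n. w i * f (x i))" if c: "c \<in> {a..b}" for c
  proof -
    define g where "g = (\<lambda>x. f x - f c - f' c * (x - c) - \<Phi> \<bar>x - c\<bar>)"
    have "0 \<le> (\<Sum>i=1..n. w i * g (x i))"
      unfolding g_def
      by (intro valley[OF c] tangent_gap_valley[OF assms(2,3,7) c]) (simp add: \<open>\<Phi> 0 = 0\<close>)
    \<comment> \<open>The tangent line at \<open>c\<close> is regrouped as intercept plus slope
      times \<open>x i\<close>, ready for \<open>sum_affine\<close>.\<close>
    also have "\<dots> = (\<Sum>i=1..n. w i * f (x i)) - (\<Sum>i=1..n. w i * \<Phi> \<bar>x i - c\<bar>)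
        - (\<Sum>i=1..n. w i * ((f c - f' c * c) + f' c * x i))"
      unfolding sum_subtractf[symmetric] g_def
      by (rule sum.cong) (auto simp: algebra_simps)
    also have "\<dots> = (\<Sum>i=1..n. w i * f (x i)) - (\<Sum>i=1..n. w i * \<Phi> \<bar>x i - c\<bar>)
        - A n * (f c + f' c * (xbar - c))"
      by (simp only: sum_affine) (simp add: algebra_simps)
    finally have "f c + f' c * (xbar - c)
        \<le> ((\<Sum>i=1..n. w i * f (x i)) - (\<Sum>i=1..n. w i * \<Phi> \<bar>x i - c\<bar>)) / A n"
      using \<open>0 < A n\<close> by (simp add: pos_le_divide_eq mult.commute)
    then show ?thesis
      by (simp add: diff_divide_distrib)
  qed
  have \<Phi>_mono: "mono_on {0..b - a} \<Phi>"
    using assms(3,5) by (intro mono_on_if_deriv_within_nonneg[of _ _ _ \<Phi>'])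
       (auto simp: C1_on_interval_def)
  have "0 \<le> 1 / A n * (\<Sum>i=1..n. w i * \<Phi> \<bar>x i - c\<bar>)" if c: "c \<in> {a..b}" for c
  proof -
    \<comment> \<open>The unreduced application lets \<open>valley\<close> read off its
      \<open>g\<close> by unification.\<close>
    have "0 \<le> (\<Sum>i=1..n. w i * (\<lambda>x. \<Phi> \<bar>x - c\<bar>) (x i))"
    proof (rule valley[OF c])
      show "antimono_on {a..c} (\<lambda>x. \<Phi> \<bar>x - c\<bar>)" "mono_on {c..b} (\<lambda>x. \<Phi> \<bar>x - c\<bar>)"
        using c by (auto intro!: monotone_onI monotone_onD[OF \<Phi>_mono])
    qed (simp add: \<open>\<Phi> 0 = 0\<close>)
    then show ?thesis
      using \<open>0 < A n\<close> by simp
  qed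
  \<comment> \<open>At \<open>c = xbar\<close> the slope term vanishes, which gives the middle
    claim.\<close>
  with main main[OF xbar] xbar show ?thesis
    by (auto simp: algebra_simps)
qed

end
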